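(* Let $\lambda\ge1$, $n\ge2$, $k\ge1$, $1\le s\le k$ be integers, let $x$ be the frequency vector of an $\mathrm{OA}(\lambda n^s,k,n,s)$, and let $$\Omega_2=\left\{d\in\{s+1,\ldots,k\}\ \middle|\ \lambda\binom{d-1}{d-1-s}\equiv 0\pmod n\right\}.$$ Let $Gx$ be the orbit of $x$ under $G=S_n\wr S_k$. Then there exists $T\subseteq\Omega_2$ such that the following hold. (i) $$\dim\left(\mathrm{Conv}(Gx)\right)=n^k-\sum_{j=0}^s\binom{k}{j}(n-1)^j-\sum_{d\in T}\binom{k}{d}(n-1)^d.$$ (ii) The affine hull $\mathrm{Aff}(\mathrm{Conv}(Gx))=\mathrm{Aff}(Gx)$ is the set of all $z\in\mathbb{R}^{n^k}$ such that, for all $(i_1,\ldots,i_k)\in\{l_1,\ldots,l_n\}^k$: $J_\emptyset^{z}(i_1,\ldots,i_k)=\lambda n^s$; $J_u^{z}(i_1,\ldots,i_k)=0$ for all $u\subseteq[k]$ with $1\le|u|\le s$; and $J_{u''}^{z}(i_1,\ldots,i_k)=0$ for all $u''\subseteq[k]$ with $|u''|\in T$.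
   Context: $[k]=\{1,\ldots,k\}$. Fix $n$ symbols $l_1,\ldots,l_n$. An orthogonal array $\mathrm{OA}(\lambda n^s,k,n,s)$ is a $\lambda n^s\times k$ array with entries in $\{l_1,\ldots,l_n\}$ such that in every choice of $s$ columns each of the $n^s$ symbol combinations appears as a row exactly $\lambda$ times. Its frequency vector $x\in\mathbb{Z}^{n^k}$, indexed by $\{l_1,\ldots,l_n\}^k$, counts how often each $(i_1,\ldots,i_k)$ appears as a row. For any real or complex vector $x$ indexed by $\{l_1,\ldots,l_n\}^k$ and $u\subseteq[k]$ define recursively $$x_u(i_1,\ldots,i_k)=n^{-k+|u|}\sum_{\{i_j\mid j\notin u\}}x(i_1,\ldots,i_k)-\sum_{v\subsetneq u}x_v(i_1,\ldots,i_k)$$ (the first sum is over all values of the indices $i_j$, $j\notin u$), and $J_u^{x}(i_1,\ldots,i_k)=n^kx_u(i_1,\ldots,i_k)$. The group $S_n\wr S_k$ consists of elements $((h_1,\ldots,h_k),g)$ with $h_j$ permutations of $\{l_1,\ldots,l_n\}$ and $g$ a permutation of $[k]$; such an element $\varphi$ acts on tuples by $\varphi(i_1,\ldots,i_k)=(h_1(i_{g^{-1}(1)}),\ldots,h_k(i_{g^{-1}(k)}))$ and on vectors indexed by tuples by permuting coordinates, $(\varphi x)(\varphi(i))=x(i)$. The dimension of a convex set is the dimension of its affine hull. *)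

theory Defs
  imports "HOL-Analysis.Analysis" "HOL-Number_Theory.Cong"
begin

text \<open>
  The \<open>n\<close> symbols are the elements of a finite type \<open>'l\<close>, the \<open>k\<close> columns those of a finite
  type \<open>'k\<close>. A tuple \<open>(i\<^sub>1, \<dots>, i\<^sub>k)\<close> is an element of \<open>'l ^ 'k\<close>, and a vector
  indexed by tuples is an element of \<open>'a ^ ('l ^ 'k)\<close>, so that \<open>real ^ ('l ^ 'k)\<close> is a
  Euclidean space of dimension \<open>n ^ k\<close>.
\<close>

text \<open>
  An array is the list of its rows. A combination of symbols in the columns \<open>C\<close> is given by
  (the restriction to \<open>C\<close> of) a full tuple \<open>t\<close>.
\<close>

definition orthogonal_array :: "nat \<Rightarrow> nat \<Rightarrow> ('l::finite ^ 'k::finite) list \<Rightarrow> bool" where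
  "orthogonal_array lam s A \<longleftrightarrow>
     length A = lam * CARD('l) ^ s \<and>
     (\<forall>C :: 'k set. card C = s \<longrightarrow>
        (\<forall>t :: 'l ^ 'k. length (filter (\<lambda>r. \<forall>j\<in>C. r $ j = t $ j) A) = lam))"

definition frequency_vector :: "('l::finite ^ 'k::finite) list \<Rightarrow> real ^ ('l ^ 'k)" where
  "frequency_vector A = (\<chi> i. of_nat (count_list A i))"

function J_component ::
  "'a::field_char_0 ^ ('l::finite ^ 'k::finite) \<Rightarrow> 'k set \<Rightarrow> 'a ^ ('l ^ 'k)" where
  "J_component x u =
     (\<chi> i. of_nat CARD('l) powi (- int CARD('k) + int (card u)) *
             (\<Sum>i' | \<forall>j\<in>u. i' $ j = i $ j. x $ i')
           - (\<Sum>v | v \<subset> u. J_component x v $ i))"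
  by auto
termination
  by (relation "Wellfounded.measure (\<lambda>(x, u). card u)") (auto intro: psubset_card_mono)

declare J_component.simps [simp del]

definition J_characteristic ::
  "'a::field_char_0 ^ ('l::finite ^ 'k::finite) \<Rightarrow> 'k set \<Rightarrow> 'a ^ ('l ^ 'k)" where
  "J_characteristic x u = (\<chi> i. of_nat CARD('l) ^ CARD('k) * J_component x u $ i)"

definition wreath_sym :: "(('k::finite \<Rightarrow> 'l::finite \<Rightarrow> 'l) \<times> ('k \<Rightarrow> 'k)) set" where
  "wreath_sym = {(h, g). (\<forall>j. bij (h j)) \<and> bij g}"

definition act_tuple ::
  "('k::finite \<Rightarrow> 'l::finite \<Rightarrow> 'l) \<times> ('k \<Rightarrow> 'k) \<Rightarrow> 'l ^ 'k \<Rightarrow> 'l ^ 'k" where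
  "act_tuple \<phi> i = (\<chi> j. fst \<phi> j (i $ inv (snd \<phi>) j))"

definition act_vector ::
  "('k::finite \<Rightarrow> 'l::finite \<Rightarrow> 'l) \<times> ('k \<Rightarrow> 'k) \<Rightarrow> 'a ^ ('l ^ 'k) \<Rightarrow> 'a ^ ('l ^ 'k)" where
  "act_vector \<phi> x = (\<chi> i. x $ inv (act_tuple \<phi>) i)"

lemma inj_act_tuple:
  assumes "\<phi> \<in> wreath_sym"
  shows "inj (act_tuple \<phi>)"
proof (rule injI)
  fix i i' assume eq: "act_tuple \<phi> i = act_tuple \<phi> i'"
  obtain h g where \<phi>: "\<phi> = (h, g)" and h: "\<And>j. bij (h j)" and g: "bij g"
    using assms by (auto simp: wreath_sym_def)
  have "i $ j = i' $ j" for j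
  proof -
    have "h (g j) (i $ inv g (g j)) = h (g j) (i' $ inv g (g j))"
      using eq by (simp add: act_tuple_def \<phi> vec_eq_iff)
    then show ?thesis
      using h g by (simp add: bij_is_inj inj_eq)
  qed
  then show "i = i'" by (simp add: vec_eq_iff)
qed

lemma act_vector_act_tuple:
  "\<phi> \<in> wreath_sym \<Longrightarrow> act_vector \<phi> x $ act_tuple \<phi> i = x $ i"
  by (simp add: act_vector_def inj_act_tuple)

definition wreath_orbit :: "'a ^ ('l::finite ^ 'k::finite) \<Rightarrow> ('a ^ ('l ^ 'k)) set" where
  "wreath_orbit x = (\<lambda>\<phi>. act_vector \<phi> x) ` wreath_sym"

definition Omega2 :: "nat \<Rightarrow> nat \<Rightarrow> nat \<Rightarrow> nat \<Rightarrow> nat set" where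
  "Omega2 lam n k s = {d \<in> {s + 1..k}. [lam * ((d - 1) choose (d - 1 - s)) = 0] (mod n)}"

end

theory Submission imports Defs
begin

text \<open>
  Write \<open>n\<close> and \<open>k\<close> for the numbers of symbols and of columns, and \<open>J\<^sub>u z\<close> for
  \<open>J_characteristic z u\<close>. The space of real vectors indexed by tuples is the \<open>k\<close>-fold tensor
  power of \<open>real ^ 'l\<close>, and \<open>real ^ 'l\<close> is the sum of the constants and of the vectors
  with coordinate sum \<open>0\<close>. Expanding the tensor power gives an orthogonal decomposition into
  blocks \<open>W\<^sub>u\<close>, one for each set \<open>u\<close> of columns: a vector in \<open>W\<^sub>u\<close> is constant along
  the columns outside \<open>u\<close> and sums to \<open>0\<close> along those in \<open>u\<close>. Up to the
  factor \<open>n\<^sup>k\<close>, the map \<open>z \<mapsto> J\<^sub>u z\<close> is the orthogonal projection onto \<open>W\<^sub>u\<close>;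
  the entries of its matrix are the products over \<open>j \<in> u\<close> of the factors \<open>n [i'\<^sub>j = i\<^sub>j] - 1\<close>
  (\<open>J_characteristic_eq_kernel_sum\<close>).

  The wreath product permutes the blocks with \<open>card u = d\<close> among themselves, and their sum
  \<open>V\<^sub>d\<close> is irreducible, with no two of the \<open>V\<^sub>d\<close> isomorphic. So an invariant
  subspace is a sum of some of the \<open>V\<^sub>d\<close>; in particular the linear span of the orbit of
  \<open>x\<close> is the sum of those \<open>V\<^sub>d\<close> in which \<open>x\<close> has a nonzero component. The argument
  does not go through representation theory but exhibits the required elements of the group
  algebra: the permutation matrices of the symbols span, among others, the all-ones
  matrix and all matrices \<open>(n [c = a] - 1) (n [i = a'] - 1)\<close>, and a tensor product of such
  operators sends \<open>x\<close> to \<open>(J\<^sub>u x)(a)\<close> times the column of \<open>a'\<close> in the matrix of any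
  \<open>J_characteristic _ u'\<close> with \<open>card u' = card u\<close> (\<open>J_kernel_in_span_wreath_orbit\<close>). If
  \<open>(J\<^sub>u x)(a) \<noteq> 0\<close>, these columns lie in the span of the orbit, and they
  span the block of \<open>u'\<close>.

  For the frequency vector of an orthogonal array of strength \<open>s\<close>, \<open>J\<^sub>u x\<close> is
  constantly the number of rows for \<open>u = {}\<close> and vanishes for \<open>1 \<le> card u \<le> s\<close>. Let \<open>T\<close> be the
  set of all \<open>d > s\<close> for which the component in \<open>V\<^sub>d\<close> vanishes as well. The affine hull
  of the orbit is its linear span cut by the hyperplane of vectors with the coordinate sum of
  \<open>x\<close>, and this is the set in the theorem. Its dimension is the rank of the projection onto the remaining blocks,
  hence the trace of this projection (\<open>dim_eq_trace\<close>); \<open>W\<^sub>u\<close> contributes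
  \<open>(n - 1) ^ card u\<close>.

  Finally, \<open>T\<close> is contained in \<open>Omega2\<close> for an arithmetical reason. Expanding the product
  that defines the matrix of \<open>J\<^sub>u\<close> writes \<open>J\<^sub>u x\<close> as a signed sum over the subsets
  \<open>v\<close> of \<open>u\<close> of \<open>n\<close> to the power \<open>card v\<close> times the number of rows that agree
  with a given tuple on \<open>v\<close>. The array property determines the terms with
  \<open>card v \<le> s\<close>, which add up to \<open>\<plusminus> lam * n ^ s * ((card u - 1) choose s)\<close>, and all
  other terms are divisible by \<open>n ^ (s + 1)\<close> (\<open>J_characteristic_orthogonal_array\<close>).
\<close>

section \<open>The J-characteristics as matrices\<close>

text \<open>
  The entries of the matrix of \<open>z \<mapsto> J_characteristic z u\<close>. Each factor is an entry of
  \<open>n\<close> times the orthogonal projection of \<open>real ^ 'l\<close> onto the vectors with coordinate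
  sum \<open>0\<close>; a column outside \<open>u\<close> has the factor \<open>1\<close>, an entry of \<open>n\<close>
  times the projection onto the constants.
\<close>

definition J_kernel :: "'k set \<Rightarrow> ('l::finite ^ 'k::finite) \<Rightarrow> 'l ^ 'k \<Rightarrow> real" where
  "J_kernel u i i' = (\<Prod>j\<in>u. real CARD('l) * of_bool (i' $ j = i $ j) - 1)"

lemma prod_of_bool:
  "finite u \<Longrightarrow> (\<Prod>j\<in>u. of_bool (P j)) = (of_bool (\<forall>j\<in>u. P j) :: 'a::comm_semiring_1)"
  by (induction u rule: finite_induct) auto

text \<open>
  This identity is the recursion that defines the components, read on matrices: the subsets of
  \<open>u\<close> are the terms in the expansion of a product over \<open>u\<close> of factors \<open>(t - 1) + 1\<close>.
\<close>

lemma sum_J_kernel_subsets: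
  fixes i i' :: "'l::finite ^ 'k::finite"
  shows "(\<Sum>v\<in>Pow u. J_kernel v i i') = real CARD('l) ^ card u * of_bool (\<forall>j\<in>u. i' $ j = i $ j)"
proof -
  have "(\<Sum>v\<in>Pow u. J_kernel v i i') = (\<Prod>j\<in>u. (real CARD('l) * of_bool (i' $ j = i $ j) - 1) + 1)"
    by (subst prod_add) (simp_all add: J_kernel_def)
  then show ?thesis
    by (simp add: prod.distrib prod_of_bool)
qed

lemma J_component_eq_kernel_sum:
  fixes z :: "real ^ ('l::finite ^ 'k::finite)"
  shows "J_component z u $ i = (\<Sum>i'\<in>UNIV. J_kernel u i i' * z $ i') / real CARD('l) ^ CARD('k)"
proof (induction "card u" arbitrary: u rule: less_induct)
  case less
  let ?N = "real CARD('l)"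
  have "(\<Sum>v | v \<subset> u. J_component z v $ i)
      = (\<Sum>v | v \<subset> u. (\<Sum>i'\<in>UNIV. J_kernel v i i' * z $ i') / ?N ^ CARD('k))"
    by (intro sum.cong refl less) (simp add: psubset_card_mono)
  also have "\<dots> = (\<Sum>i'\<in>UNIV. (\<Sum>v | v \<subset> u. J_kernel v i i') * z $ i') / ?N ^ CARD('k)"
    by (simp add: sum_distrib_right sum_divide_distrib sum.swap[of _ "Collect _" UNIV])
  finally have proper: "(\<Sum>v | v \<subset> u. J_component z v $ i) = \<dots>" .
  have split: "(\<Sum>v | v \<subset> u. J_kernel v i i')
      = ?N ^ card u * of_bool (\<forall>j\<in>u. i' $ j = i $ j) - J_kernel u i i'" for i'
  proof -
    have "Pow u = insert u {v. v \<subset> u}" by auto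
    then have "(\<Sum>v\<in>Pow u. J_kernel v i i') = J_kernel u i i' + (\<Sum>v | v \<subset> u. J_kernel v i i')"
      by simp
    then show ?thesis by (simp add: sum_J_kernel_subsets)
  qed
  have powi: "?N powi (- int CARD('k) + int (card u)) = ?N ^ card u / ?N ^ CARD('k)"
    using power_int_add[of ?N "- int CARD('k)" "int (card u)"] by (simp add: power_int_minus divide_simps)
  have total: "(\<Sum>i' | \<forall>j\<in>u. i' $ j = i $ j. z $ i')
      = (\<Sum>i'\<in>UNIV. of_bool (\<forall>j\<in>u. i' $ j = i $ j) * z $ i')"
    by (rule sum.mono_neutral_cong_left) auto
  have "(\<Sum>i'\<in>UNIV. (\<Sum>v | v \<subset> u. J_kernel v i i') * z $ i')
      = ?N ^ card u * (\<Sum>i' | \<forall>j\<in>u. i' $ j = i $ j. z $ i') - (\<Sum>i'\<in>UNIV. J_kernel u i i' * z $ i')"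
    unfolding split total by (simp only: left_diff_distrib sum_subtractf sum_distrib_left mult.assoc)
  then show ?case
    unfolding J_component.simps[of z u] proper powi vec_lambda_beta by (simp add: diff_divide_distrib)
qed

lemma J_characteristic_eq_kernel_sum:
  fixes z :: "real ^ ('l::finite ^ 'k::finite)"
  shows "J_characteristic z u $ i = (\<Sum>i'\<in>UNIV. J_kernel u i i' * z $ i')"
  by (simp add: J_characteristic_def J_component_eq_kernel_sum)

lemma J_kernel_commute: "J_kernel u i i' = J_kernel u i' i"
  by (simp add: J_kernel_def eq_commute)

text \<open>
  The components of a vector add up to the vector; here \<open>sum_J_kernel_subsets\<close> is used for
  the set of all columns.
\<close>

lemma sum_J_characteristic:
  fixes z :: "real ^ ('l::finite ^ 'k::finite)"
  shows "(\<Sum>u\<in>UNIV. J_characteristic z u $ i) = real CARD('l) ^ CARD('k) * z $ i"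
proof -
  have "(\<Sum>u\<in>UNIV. J_characteristic z u $ i)
      = (\<Sum>i'\<in>UNIV. (\<Sum>u\<in>Pow UNIV. J_kernel u i i') * z $ i')"
    by (simp add: J_characteristic_eq_kernel_sum sum_distrib_right sum.swap[of _ "UNIV :: 'k set set"])
  also have "\<dots> = (\<Sum>i'\<in>UNIV. if i' = i then real CARD('l) ^ CARD('k) * z $ i' else 0)"
    unfolding sum_J_kernel_subsets by (intro sum.cong) (auto simp: vec_eq_iff)
  finally show ?thesis by simp
qed

lemma sum_prod_vec:
  fixes f :: "'k::finite \<Rightarrow> 'l::finite \<Rightarrow> 'a::comm_semiring_1"
  shows "(\<Sum>i\<in>(UNIV :: ('l ^ 'k) set). \<Prod>j\<in>UNIV. f j (i $ j)) = (\<Prod>j\<in>UNIV. \<Sum>c\<in>UNIV. f j c)"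
proof -
  have "(\<Sum>i\<in>(UNIV :: ('l ^ 'k) set). \<Prod>j\<in>UNIV. f j (i $ j)) = (\<Sum>t\<in>UNIV. \<Prod>j\<in>UNIV. f j (t j))"
    by (rule sum.reindex_bij_witness[of _ vec_lambda vec_nth]) auto
  also have "\<dots> = (\<Prod>j\<in>UNIV. \<Sum>c\<in>UNIV. f j c)"
    by (subst prod_sum_PiE) simp_all
  finally show ?thesis .
qed

section \<open>Orthogonality and dimensions\<close>

text \<open>
  The sum over tuples factors over the columns, and a column that belongs to just one of
  \<open>u\<close> and \<open>v\<close> contributes a sum \<open>n - n = 0\<close>.
\<close>

lemma J_kernel_orthogonal:
  fixes i i'' :: "'l::finite ^ 'k::finite"
  assumes "u \<noteq> v"
  shows "(\<Sum>i'\<in>UNIV. J_kernel u i i' * J_kernel v i'' i') = 0"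
proof -
  define f where "f w a j c = (if j \<in> w then real CARD('l) * of_bool (c = a $ j) - 1 else 1)"
    for w :: "'k set" and a :: "'l ^ 'k" and j c
  have kernel: "J_kernel w a b = (\<Prod>j\<in>UNIV. f w a j (b $ j))" for w a b
    by (simp add: J_kernel_def f_def prod.If_cases)
  have f0: "(\<Sum>c\<in>UNIV. f w a j c) = 0" if "j \<in> w" for w a j
    using that by (simp add: f_def sum_subtractf sum_distrib_left[symmetric] of_bool_def)
  obtain j where j: "j \<in> u \<and> j \<notin> v \<or> j \<notin> u \<and> j \<in> v" using assms by blast
  have "(\<Sum>c\<in>UNIV. f u i j c * f v i'' j c) = 0"
    using j
  proof
    assume "j \<in> u \<and> j \<notin> v"
    then have "(\<Sum>c\<in>UNIV. f u i j c * f v i'' j c) = (\<Sum>c\<in>UNIV. f u i j c)"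
      by (intro sum.cong) (simp_all add: f_def)
    then show ?thesis using \<open>j \<in> u \<and> j \<notin> v\<close> f0 by simp
  next
    assume "j \<notin> u \<and> j \<in> v"
    then have "(\<Sum>c\<in>UNIV. f u i j c * f v i'' j c) = (\<Sum>c\<in>UNIV. f v i'' j c)"
      by (intro sum.cong) (simp_all add: f_def)
    then show ?thesis using \<open>j \<notin> u \<and> j \<in> v\<close> f0 by simp
  qed
  then show ?thesis
    unfolding kernel prod.distrib[symmetric]
    by (subst sum_prod_vec) (meson UNIV_I finite prod_zero)
qed

text \<open>
  The hypotheses say that \<open>P\<close> is the orthogonal projection onto \<open>L\<close>. In terms of an
  orthonormal basis \<open>B\<close> of \<open>L\<close>, it is the sum of the rank one operators
  \<open>v \<mapsto> (b \<bullet> v) b\<close>, and each of these has trace \<open>b \<bullet> b = 1\<close>.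
\<close>

lemma dim_eq_trace:
  fixes L :: "'e::euclidean_space set"
  assumes L: "subspace L" and into: "\<And>v. P v \<in> L"
    and perp: "\<And>b v. b \<in> L \<Longrightarrow> b \<bullet> P v = b \<bullet> v"
  shows "real (dim L) = (\<Sum>e\<in>Basis. e \<bullet> P e)"
proof -
  obtain B where B: "B \<subseteq> L" "pairwise orthogonal B" "\<And>b. b \<in> B \<Longrightarrow> norm b = 1"
    "independent B" "card B = dim L" "span B = L"
    using orthonormal_basis_subspace[OF L] by blast
  have fin: "finite B" using B(4) by (rule independent_imp_finite)
  have ob: "b \<bullet> b' = of_bool (b = b')" if "b \<in> B" "b' \<in> B" for b b'
    using B(2,3) that by (auto simp: pairwise_def orthogonal_def norm_eq_1)
  have P: "P v = (\<Sum>b\<in>B. (b \<bullet> v) *\<^sub>R b)" for v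
  proof -
    let ?w = "P v - (\<Sum>b\<in>B. (b \<bullet> v) *\<^sub>R b)"
    have w: "?w \<in> L"
      using L into B(1) by (intro subspace_diff subspace_sum subspace_mul) auto
    have "b \<bullet> ?w = 0" if "b \<in> B" for b
    proof -
      have "(\<Sum>b'\<in>B. (b' \<bullet> v) * (b \<bullet> b')) = (\<Sum>b'\<in>B. if b' = b then b \<bullet> v else 0)"
        using that by (intro sum.cong) (auto simp: ob)
      then show ?thesis
        using that fin B(1) perp by (simp add: inner_diff_right inner_sum_right subset_eq)
    qed
    then have "orthogonal ?w b" if "b \<in> B" for b
      using that by (simp add: orthogonal_def inner_commute)
    then have "orthogonal ?w ?w"
      using w B(6) by (metis orthogonal_to_span)
    then have "?w \<bullet> ?w = 0"
      by (simp only: orthogonal_def)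
    then show ?thesis by simp
  qed
  have "(\<Sum>e\<in>Basis. e \<bullet> P e) = (\<Sum>b\<in>B. \<Sum>e\<in>Basis. (b \<bullet> e) * (b \<bullet> e))"
    unfolding P by (simp add: inner_sum_right inner_commute sum.swap[of _ B])
  also have "\<dots> = (\<Sum>b\<in>B. b \<bullet> b)"
    by (intro sum.cong refl euclidean_inner[symmetric])
  finally show ?thesis using B(5) ob by simp
qed

lemma linear_J_characteristic:
  "linear (\<lambda>z :: real ^ ('l::finite ^ 'k::finite). J_characteristic z u)"
  by (intro linearI)
    (simp_all add: vec_eq_iff J_characteristic_eq_kernel_sum distrib_left sum.distrib
      sum_distrib_left mult.left_commute)

lemma J_characteristic_J_characteristic:
  fixes z :: "real ^ ('l::finite ^ 'k::finite)"
  assumes "u \<noteq> w"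
  shows "J_characteristic (J_characteristic z u) w = 0"
proof -
  have "J_characteristic (J_characteristic z u) w $ i = 0" for i
  proof -
    have "J_characteristic (J_characteristic z u) w $ i
        = (\<Sum>i'\<in>UNIV. \<Sum>a\<in>UNIV. J_kernel w i i' * J_kernel u a i' * z $ a)"
      unfolding J_characteristic_eq_kernel_sum sum_distrib_left mult.assoc
      by (simp only: J_kernel_commute[of u])
    also have "\<dots> = (\<Sum>a\<in>UNIV. (\<Sum>i'\<in>UNIV. J_kernel w i i' * J_kernel u a i') * z $ a)"
      unfolding sum_distrib_right by (rule sum.swap)
    also have "\<dots> = 0"
      using assms by (simp add: J_kernel_orthogonal)
    finally show ?thesis .
  qed
  then show ?thesis by (simp add: vec_eq_iff)
qed

lemma inner_J_characteristic:
  fixes y z :: "real ^ ('l::finite ^ 'k::finite)"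
  shows "y \<bullet> J_characteristic z u = J_characteristic y u \<bullet> z"
proof -
  have "y \<bullet> J_characteristic z u
      = (\<Sum>i\<in>UNIV. \<Sum>i'\<in>UNIV. y $ i * (J_kernel u i i' * z $ i'))"
    by (simp add: inner_vec_def J_characteristic_eq_kernel_sum sum_distrib_left)
  also have "\<dots> = (\<Sum>i'\<in>UNIV. \<Sum>i\<in>UNIV. J_kernel u i' i * y $ i * z $ i')"
    by (subst sum.swap) (simp add: J_kernel_commute[of u] mult_ac)
  also have "\<dots> = J_characteristic y u \<bullet> z"
    by (simp add: inner_vec_def J_characteristic_eq_kernel_sum sum_distrib_right)
  finally show ?thesis .
qed

text \<open>
  The orthogonal complement of the blocks \<open>W\<^sub>u\<close> with \<open>card u \<in> D\<close>. It will be the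
  direction of the affine hull of the orbit.
\<close>

definition J_vanishing :: "nat set \<Rightarrow> (real ^ ('l::finite ^ 'k::finite)) set" where
  "J_vanishing D = {z. \<forall>u. card u \<in> D \<longrightarrow> J_characteristic z u = 0}"

lemma subspace_J_vanishing: "subspace (J_vanishing D)"
  unfolding subspace_def J_vanishing_def
  by (simp add: linear_0[OF linear_J_characteristic] linear_add[OF linear_J_characteristic]
      linear_cmul[OF linear_J_characteristic])

lemma sum_card_subsets:
  fixes f :: "nat \<Rightarrow> 'a::comm_semiring_1"
  assumes "finite U"
  shows "(\<Sum>u | u \<subseteq> U \<and> card u \<in> D. f (card u))
       = (\<Sum>d\<in>D \<inter> {0..card U}. of_nat (card U choose d) * f d)"
proof -
  have "(\<Sum>u | u \<subseteq> U \<and> card u \<in> D. f (card u))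
      = (\<Sum>d\<in>D \<inter> {0..card U}. \<Sum>u | u \<in> {u. u \<subseteq> U \<and> card u \<in> D} \<and> card u = d. f (card u))"
    using assms by (intro sum.group[symmetric]) (auto intro: card_mono)
  also have "\<dots> = (\<Sum>d\<in>D \<inter> {0..card U}. \<Sum>u | u \<subseteq> U \<and> card u = d. f d)"
    by (intro sum.cong refl) auto
  finally show ?thesis by (simp add: n_subsets[OF assms])
qed

text \<open>
  The normalized sum of the \<open>J_characteristic _ u\<close> over all \<open>u\<close> with
  \<open>card u \<notin> D\<close> is the orthogonal projection onto this space. All diagonal entries
  of the matrix of \<open>J_characteristic _ u\<close> equal \<open>(n - 1) ^ card u\<close>, so the dimension can
  be read off from the trace.
\<close>

lemma dim_J_vanishing:
  assumes "D \<subseteq> {0..CARD('k)}"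
  shows "int (dim (J_vanishing D :: (real ^ ('l::finite ^ 'k::finite)) set))
     = int CARD('l) ^ CARD('k) - (\<Sum>d\<in>D. int (CARD('k) choose d) * (int CARD('l) - 1) ^ d)"
proof -
  let ?V = "J_vanishing D :: (real ^ ('l ^ 'k)) set"
  let ?N = "real CARD('l)" and ?M = "real CARD('l) ^ CARD('k)"
  let ?E = "{u :: 'k set. card u \<notin> D}"
  have M: "?M > 0" by simp
  define P :: "real ^ ('l ^ 'k) \<Rightarrow> real ^ ('l ^ 'k)" where
    "P v = (\<Sum>u\<in>?E. J_characteristic v u) /\<^sub>R ?M" for v
  have into: "P v \<in> ?V" for v
    by (auto simp: J_vanishing_def P_def linear_cmul[OF linear_J_characteristic]
        linear_sum[OF linear_J_characteristic] intro!: sum.neutral J_characteristic_J_characteristic)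
  have fixed: "P b = b" if "b \<in> ?V" for b
  proof -
    have "(\<Sum>u\<in>?E. J_characteristic b u) = (\<Sum>u\<in>UNIV. J_characteristic b u)"
      using that by (intro sum.mono_neutral_left) (auto simp: J_vanishing_def)
    also have "\<dots> = ?M *\<^sub>R b"
      by (simp add: vec_eq_iff sum_J_characteristic)
    finally show ?thesis using M by (simp add: P_def)
  qed
  have self_adjoint: "b \<bullet> P v = P b \<bullet> v" for b v
    by (simp add: P_def inner_sum_right inner_sum_left inner_J_characteristic)
  have J_axis: "J_characteristic (axis i 1) u $ i = (?N - 1) ^ card u" for u and i :: "'l ^ 'k"
  proof -
    have "J_characteristic (axis i 1) u $ i = J_kernel u i i"
      by (simp add: J_characteristic_eq_kernel_sum axis_def if_distrib cong: if_cong)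
    then show ?thesis by (simp add: J_kernel_def)
  qed
  have Basis: "(Basis :: (real ^ ('l ^ 'k)) set) = range (\<lambda>i. axis i 1)"
    by (auto simp: Basis_vec_def)
  have "real (dim ?V) = (\<Sum>e\<in>Basis. e \<bullet> P e)"
    using subspace_J_vanishing into by (rule dim_eq_trace) (simp add: self_adjoint fixed)
  also have "\<dots> = (\<Sum>i\<in>UNIV. P (axis i 1) $ i)"
    unfolding Basis by (subst sum.reindex) (auto simp: inj_on_def axis_eq_axis inner_axis' )
  also have "\<dots> = (\<Sum>i\<in>(UNIV :: ('l ^ 'k) set). (\<Sum>u\<in>?E. (?N - 1) ^ card u) / ?M)"
    by (simp add: P_def J_axis divide_inverse mult.commute)
  also have "\<dots> = (\<Sum>u\<in>?E. (?N - 1) ^ card u)"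
    using M by simp
  finally have trace: "real (dim ?V) = (\<Sum>u\<in>?E. (?N - 1) ^ card u)" .
  \<comment> \<open>The sizes of all blocks add up to \<open>((n - 1) + 1) ^ k\<close> by the binomial expansion.\<close>
  have "(\<Sum>u\<in>?E. (?N - 1) ^ card u) + (\<Sum>u | card (u :: 'k set) \<in> D. (?N - 1) ^ card u)
      = (\<Sum>u\<in>(UNIV :: 'k set set). (?N - 1) ^ card u)"
    by (subst sum.union_disjoint[symmetric]) (auto intro!: sum.cong)
  also have "\<dots> = (\<Prod>j\<in>(UNIV :: 'k set). (?N - 1) + 1)"
    by (subst prod_add) simp_all
  also have "\<dots> = ?M" by simp
  finally have "real (dim ?V) = ?M - (\<Sum>d\<in>D. real (CARD('k) choose d) * (?N - 1) ^ d)"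
    using assms trace sum_card_subsets[of "UNIV :: 'k set" "\<lambda>d. (?N - 1) ^ d" D]
    by (simp add: Int_absorb2)
  then have "real_of_int (int (dim ?V)) = real_of_int (int CARD('l) ^ CARD('k)
      - (\<Sum>d\<in>D. int (CARD('k) choose d) * (int CARD('l) - 1) ^ d))"
    by simp
  then show ?thesis by (simp only: of_int_eq_iff)
qed

section \<open>Linear combinations of permutation matrices\<close>

text \<open>
  Matrices indexed by symbols that lie in the linear span of the permutation matrices, that is, in
  the image of the group algebra of the symmetric group. The weight \<open>w\<close> is an element of the
  group algebra.
\<close>

definition perm_combination :: "('l::finite \<Rightarrow> 'l \<Rightarrow> real) \<Rightarrow> bool" where
  "perm_combination m \<longleftrightarrow> (\<exists>w. \<forall>c i. m c i = (\<Sum>p | bij p. w p * of_bool (p c = i)))"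

lemma perm_combination_perm:
  fixes q :: "'l::finite \<Rightarrow> 'l"
  assumes "bij q"
  shows "perm_combination (\<lambda>c i. of_bool (q c = i))"
  unfolding perm_combination_def
proof (intro exI allI)
  fix c i
  have "(\<Sum>p | bij p. of_bool (p = q) * (of_bool (p c = i) :: real)) = (\<Sum>p\<in>{q}. of_bool (p c = i))"
    using assms by (intro sum.mono_neutral_cong_right) auto
  then show "of_bool (q c = i) = (\<Sum>p | bij p. of_bool (p = q) * (of_bool (p c = i) :: real))"
    by simp
qed

lemma perm_combination_add:
  assumes "perm_combination m" "perm_combination m'"
  shows "perm_combination (\<lambda>c i. m c i + m' c i)"
proof -
  obtain w where "\<And>c i. m c i = (\<Sum>p | bij p. w p * of_bool (p c = i))"
    using assms(1) unfolding perm_combination_def by blast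
  moreover obtain w' where "\<And>c i. m' c i = (\<Sum>p | bij p. w' p * of_bool (p c = i))"
    using assms(2) unfolding perm_combination_def by blast
  ultimately show ?thesis
    unfolding perm_combination_def
    by (intro exI[of _ "\<lambda>p. w p + w' p"]) (simp add: distrib_right sum.distrib)
qed

lemma perm_combination_scale:
  assumes "perm_combination m"
  shows "perm_combination (\<lambda>c i. r * m c i)"
proof -
  obtain w where "\<And>c i. m c i = (\<Sum>p | bij p. w p * of_bool (p c = i))"
    using assms unfolding perm_combination_def by blast
  then show ?thesis
    unfolding perm_combination_def
    by (intro exI[of _ "\<lambda>p. r * w p"]) (simp only: sum_distrib_left mult.assoc simp_thms)
qed

lemma perm_combination_zero: "perm_combination (\<lambda>c i. 0)"
  unfolding perm_combination_def by (intro exI[of _ "\<lambda>p. 0"]) simp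

lemma perm_combination_sum:
  assumes "finite S" "\<And>b. b \<in> S \<Longrightarrow> perm_combination (m b)"
  shows "perm_combination (\<lambda>c i. \<Sum>b\<in>S. m b c i)"
  using assms
  by (induction S rule: finite_induct) (auto intro: perm_combination_add perm_combination_zero)

lemma ex_perm_two_points:
  fixes a b a' b' :: 'a
  assumes "a \<noteq> b" "a' \<noteq> b'"
  obtains p where "bij p" "p a = a'" "p b = b'"
proof
  define q where "q = Transposition.transpose a a'"
  show "bij (Transposition.transpose (q b) b' \<circ> q)" "(Transposition.transpose (q b) b' \<circ> q) b = b'"
    by (simp_all add: q_def bij_comp)
  have "q b \<noteq> a'" using assms by (auto simp: q_def Transposition.transpose_def)
  then show "(Transposition.transpose (q b) b' \<circ> q) a = a'"
    using assms by (simp add: q_def Transposition.transpose_def)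
qed

text \<open>
  If \<open>p\<close> maps \<open>a\<close> to \<open>a'\<close> and \<open>b\<close> to \<open>b'\<close>, then \<open>p\<close> and its composition with
  the transposition of \<open>a'\<close> and \<open>b'\<close> differ only on \<open>a\<close> and \<open>b\<close>, and the difference of
  their matrices is the given matrix of rank one.
\<close>

lemma perm_combination_difference:
  "perm_combination (\<lambda>c i. (of_bool (c = a) - of_bool (c = b)) * (of_bool (i = a') - of_bool (i = b')))"
proof (cases "a = b \<or> a' = b'")
  case True
  then show ?thesis using perm_combination_zero by auto
next
  case False
  then obtain p where p: "bij p" "p a = a'" "p b = b'"
    using ex_perm_two_points by metis
  have inj: "p c = p c' \<longleftrightarrow> c = c'" for c c'
    using p(1) by (simp add: bij_is_inj inj_eq)
  have "(of_bool (c = a) - of_bool (c = b)) * (of_bool (i = a') - of_bool (i = b'))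
      = of_bool (p c = i) + (-1) * (of_bool ((Transposition.transpose a' b' \<circ> p) c = i) :: real)" for c i
    unfolding p(2,3)[symmetric] using False
    by (cases "c = a"; cases "c = b") (auto simp: Transposition.transpose_def inj)
  then show ?thesis
    using p(1) by (simp only:) (intro perm_combination_add perm_combination_scale
        perm_combination_perm bij_comp bij_transpose)
qed

text \<open>
  Summing the matrices of \<open>perm_combination_difference\<close> over \<open>b\<close> and \<open>b'\<close> replaces
  the differences of unit vectors by \<open>n\<close> times the projections of the unit vectors of \<open>a\<close>
  and \<open>a'\<close> onto the vectors with coordinate sum \<open>0\<close>.
\<close>

lemma perm_combination_centred:
  "perm_combination (\<lambda>c i. (real CARD('l) * of_bool (c = a) - 1) * (real CARD('l) * of_bool (i = a') - 1))"
  for a a' :: "'l::finite"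
proof -
  have "(\<Sum>b\<in>UNIV. of_bool (c = a) - of_bool (c = b)) = real CARD('l) * of_bool (c = a) - 1"
    for c a :: 'l
    by (simp add: sum_subtractf of_bool_def)
  then have "(real CARD('l) * of_bool (c = a) - 1) * (real CARD('l) * of_bool (i = a') - 1)
      = (\<Sum>b\<in>UNIV. \<Sum>b'\<in>UNIV. (of_bool (c = a) - of_bool (c = b)) * (of_bool (i = a') - of_bool (i = b')))"
    for c i
    by (simp only: sum_product[symmetric])
  then show ?thesis
    by (simp only:) (intro perm_combination_sum perm_combination_difference finite)
qed

text \<open>
  The identity matrix, itself a permutation matrix, is the sum of two projections: one onto the vectors with coordinate sum
  \<open>0\<close>, which is a combination of centred matrices, and one onto the constants, which is a
  multiple of the all-ones matrix.
\<close>

lemma perm_combination_one: "perm_combination (\<lambda>c (i :: 'l::finite). 1)"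
proof -
  let ?N = "real CARD('l)"
  have "(\<Sum>a\<in>UNIV. (?N * of_bool (c = a) - 1) * (?N * of_bool (i = a) - 1))
      = ?N * ?N * of_bool (c = i) - ?N" for c i :: 'l
  proof -
    have "(\<Sum>a\<in>UNIV. (?N * of_bool (c = a) - 1) * (?N * of_bool (i = a) - 1))
        = (\<Sum>a\<in>UNIV. ?N * ?N * (of_bool (c = i) * of_bool (c = a))
             - ?N * of_bool (c = a) - ?N * of_bool (i = a) + 1)"
      by (intro sum.cong) (auto simp: algebra_simps)
    then show ?thesis
      by (simp add: sum.distrib sum_subtractf sum_distrib_left[symmetric] of_bool_def)
  qed
  then have "?N * of_bool (id c = i)
      + (- 1 / ?N) * (\<Sum>a\<in>UNIV. (?N * of_bool (c = a) - 1) * (?N * of_bool (i = a) - 1)) = 1"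
    for c i :: 'l
    by (simp add: field_simps)
  moreover have "perm_combination (\<lambda>c i :: 'l. ?N * of_bool (id c = i)
      + (- 1 / ?N) * (\<Sum>a\<in>UNIV. (?N * of_bool (c = a) - 1) * (?N * of_bool (i = a) - 1)))"
    by (intro perm_combination_add perm_combination_scale perm_combination_sum
        perm_combination_centred perm_combination_perm bij_id finite)
  ultimately show ?thesis by (simp only:)
qed

section \<open>The span of an orbit\<close>

lemma inv_act_tuple_eq_iff:
  assumes "\<phi> \<in> wreath_sym"
  shows "i' = inv (act_tuple \<phi>) i \<longleftrightarrow> act_tuple \<phi> i' = i"
proof -
  have "bij (act_tuple \<phi>)"
    using inj_act_tuple[OF assms] by (simp add: finite_UNIV_inj_surj bij_def)
  then show ?thesis by (metis bij_inv_eq_iff)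
qed

text \<open>
  The group algebra of the wreath product contains the tensor products of elements of the
  group algebras of the \<open>k\<close> factors \<open>S\<^sub>n\<close>: multiplying out the product over the columns
  gives a sum over families \<open>h\<close> of permutations, and each of them, together with \<open>g\<close>, is
  a group element.
\<close>

lemma tensor_in_span_wreath_orbit:
  fixes x :: "real ^ ('l::finite ^ 'k::finite)"
  assumes g: "bij g" and m: "\<And>j. perm_combination (m j)"
  shows "(\<chi> i. \<Sum>i'\<in>UNIV. (\<Prod>j\<in>UNIV. m j (i' $ inv g j) (i $ j)) * x $ i') \<in> span (wreath_orbit x)"
proof -
  have "\<forall>j. \<exists>w. \<forall>c i. m j c i = (\<Sum>p | bij p. w p * of_bool (p c = i))"
    using m unfolding perm_combination_def by blast
  then obtain w where w: "\<And>j c i. m j c i = (\<Sum>p | bij p. w j p * of_bool (p c = i))"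
    unfolding choice_iff by blast
  define H where "H = PiE (UNIV :: 'k set) (\<lambda>_. {p :: 'l \<Rightarrow> 'l. bij p})"
  have H: "(h, g) \<in> wreath_sym" if "h \<in> H" for h
    using that g by (auto simp: H_def wreath_sym_def PiE_UNIV_domain)
  have tensor: "(\<Prod>j\<in>UNIV. m j (i' $ inv g j) (i $ j))
      = (\<Sum>h\<in>H. (\<Prod>j\<in>UNIV. w j (h j)) * of_bool (act_tuple (h, g) i' = i))" for i i'
    unfolding w H_def
    by (subst prod_sum_PiE)
      (simp_all add: prod.distrib prod_of_bool act_tuple_def vec_eq_iff)
  have pick: "(\<Sum>i'\<in>UNIV. of_bool (act_tuple (h, g) i' = i) * x $ i') = act_vector (h, g) x $ i"
    if "h \<in> H" for h i
  proof -
    have "(\<Sum>i'\<in>UNIV. of_bool (act_tuple (h, g) i' = i) * x $ i')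
        = (\<Sum>i'\<in>UNIV. if i' = inv (act_tuple (h, g)) i then x $ i' else 0)"
      using inv_act_tuple_eq_iff[OF H[OF that]] by (intro sum.cong) auto
    then show ?thesis by (simp add: act_vector_def)
  qed
  have "(\<Sum>i'\<in>UNIV. (\<Prod>j\<in>UNIV. m j (i' $ inv g j) (i $ j)) * x $ i')
      = (\<Sum>h\<in>H. (\<Prod>j\<in>UNIV. w j (h j)) *\<^sub>R act_vector (h, g) x) $ i" for i
  proof -
    have "(\<Sum>i'\<in>UNIV. (\<Prod>j\<in>UNIV. m j (i' $ inv g j) (i $ j)) * x $ i')
       = (\<Sum>h\<in>H. (\<Prod>j\<in>UNIV. w j (h j)) * (\<Sum>i'\<in>UNIV. of_bool (act_tuple (h, g) i' = i) * x $ i'))"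
      unfolding tensor sum_distrib_right sum_distrib_left mult.assoc by (rule sum.swap)
    then show ?thesis
      by (simp only: pick sum_component vector_scaleR_component real_scaleR_def cong: sum.cong)
  qed
  then have "(\<chi> i. \<Sum>i'\<in>UNIV. (\<Prod>j\<in>UNIV. m j (i' $ inv g j) (i $ j)) * x $ i')
      = (\<Sum>h\<in>H. (\<Prod>j\<in>UNIV. w j (h j)) *\<^sub>R act_vector (h, g) x)"
    by (simp add: vec_eq_iff)
  also have "\<dots> \<in> span (wreath_orbit x)"
    using H by (intro span_sum span_scale span_base) (auto simp: wreath_orbit_def)
  finally show ?thesis .
qed

lemma ex_bij_image_eq:
  fixes u v :: "'a::finite set"
  assumes "card u = card v"
  obtains g where "bij g" "g ` u = v"
proof -
  obtain f where f: "bij_betw f u v"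
    using assms finite_same_card_bij[of u v] by auto
  obtain f' where f': "bij_betw f' (- u) (- v)"
    using assms finite_same_card_bij[of "- u" "- v"] by (auto simp: Compl_eq_Diff_UNIV card_Diff_subset)
  define g where "g j = (if j \<in> u then f j else f' j)" for j
  have "bij_betw g u v" "bij_betw g (- u) (- v)"
    using f f' bij_betw_cong[of u f g v] bij_betw_cong[of "- u" f' g "- v"] by (simp_all add: g_def)
  then show thesis
    using that[of g] bij_betw_combine[of g u v "- u" "- v"] by (simp add: bij_betw_imp_surj_on)
qed

text \<open>
  The tensor product of centred matrices in the columns of \<open>u'\<close> and all-ones matrices elsewhere,
  preceded by a permutation of the columns that carries \<open>u\<close> to \<open>u'\<close>, is the rank one
  operator that evaluates \<open>J_characteristic x u\<close> at \<open>a\<close> and multiplies the vector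
  \<open>J_kernel u' a'\<close> by the result. One nonzero value of \<open>J_characteristic x u\<close>
  therefore yields a spanning set of every block \<open>W\<^sub>v\<close> with \<open>card v = card u\<close>.
\<close>

lemma J_kernel_in_span_wreath_orbit:
  fixes x :: "real ^ ('l::finite ^ 'k::finite)"
  assumes nz: "J_characteristic x u $ a \<noteq> 0" and card: "card u = card u'"
  shows "(\<chi> i. J_kernel u' a' i) \<in> span (wreath_orbit x)"
proof -
  let ?N = "real CARD('l)"
  obtain g where g: "bij g" "g ` u = u'"
    using ex_bij_image_eq card by blast
  define m where "m j = (if j \<in> u'
      then (\<lambda>c i. (?N * of_bool (c = a $ inv g j) - 1) * (?N * of_bool (i = a' $ j) - 1))
      else (\<lambda>c i. 1))" for j
  have m: "perm_combination (m j)" for j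
    by (simp add: m_def perm_combination_centred perm_combination_one)
  have "(\<Prod>j\<in>UNIV. m j (i' $ inv g j) (i $ j)) = J_kernel u' a' i * J_kernel u a i'" for i i'
  proof -
    have "(\<Prod>j\<in>UNIV. m j (i' $ inv g j) (i $ j))
       = (\<Prod>j\<in>u'. (?N * of_bool (i' $ inv g j = a $ inv g j) - 1) * (?N * of_bool (i $ j = a' $ j) - 1))"
      by (rule prod.mono_neutral_cong_right) (auto simp: m_def)
    also have "\<dots> = J_kernel u' a' i * (\<Prod>j\<in>g ` u. ?N * of_bool (i' $ inv g j = a $ inv g j) - 1)"
      by (simp add: prod.distrib J_kernel_def g(2))
    also have "(\<Prod>j\<in>g ` u. ?N * of_bool (i' $ inv g j = a $ inv g j) - 1) = J_kernel u a i'"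
      using inj_on_subset[OF bij_is_inj[OF g(1)] subset_UNIV, of u]
      by (simp add: prod.reindex J_kernel_def bij_is_inj[OF g(1)])
    finally show ?thesis .
  qed
  then have "(\<Sum>i'\<in>UNIV. (\<Prod>j\<in>UNIV. m j (i' $ inv g j) (i $ j)) * x $ i')
      = J_characteristic x u $ a * J_kernel u' a' i" for i
    by (simp add: J_characteristic_eq_kernel_sum sum_distrib_left mult_ac)
  then have "(\<chi> i. J_kernel u' a' i) = (1 / J_characteristic x u $ a) *\<^sub>R
      (\<chi> i. \<Sum>i'\<in>UNIV. (\<Prod>j\<in>UNIV. m j (i' $ inv g j) (i $ j)) * x $ i')"
    using nz by (simp add: vec_eq_iff)
  then show ?thesis
    using tensor_in_span_wreath_orbit[OF g(1) m] by (simp only: span_scale)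
qed

lemma J_characteristic_in_span_wreath_orbit:
  fixes x z :: "real ^ ('l::finite ^ 'k::finite)"
  assumes "J_characteristic x u \<noteq> 0" "card u = card u'"
  shows "J_characteristic z u' \<in> span (wreath_orbit x)"
proof -
  obtain a where a: "J_characteristic x u $ a \<noteq> 0"
    using assms(1) by (auto simp: vec_eq_iff)
  have "J_characteristic z u' = (\<Sum>a'\<in>UNIV. z $ a' *\<^sub>R (\<chi> i. J_kernel u' a' i))"
    by (simp add: vec_eq_iff J_characteristic_eq_kernel_sum J_kernel_commute[of u'] mult.commute)
  then show ?thesis
    using J_kernel_in_span_wreath_orbit[OF a assms(2)] by (simp add: span_sum span_scale)
qed

text \<open>
  The hypothesis says that \<open>z\<close> has components only in the isotypic parts \<open>V\<^sub>d\<close> where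
  \<open>x\<close> has one. Each component of \<open>z\<close> then lies in the span of the orbit, and \<open>z\<close> is the
  sum of its components.
\<close>

lemma in_span_wreath_orbitI:
  fixes x z :: "real ^ ('l::finite ^ 'k::finite)"
  assumes "\<And>u. J_characteristic z u \<noteq> 0 \<Longrightarrow> \<exists>w. card w = card u \<and> J_characteristic x w \<noteq> 0"
  shows "z \<in> span (wreath_orbit x)"
proof -
  have "J_characteristic z u \<in> span (wreath_orbit x)" for u
    using assms[of u] J_characteristic_in_span_wreath_orbit span_zero by metis
  moreover have "z = (1 / real CARD('l) ^ CARD('k)) *\<^sub>R (\<Sum>u\<in>UNIV. J_characteristic z u)"
    by (simp add: vec_eq_iff sum_J_characteristic)
  ultimately show ?thesis by (metis span_scale span_sum)
qed

text \<open>
  The group permutes the blocks, because \<open>J_kernel\<close> only records in which columns two tuples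
  agree, and these columns are moved by the permutation of the columns alone.
\<close>

lemma J_characteristic_act_vector:
  fixes x :: "real ^ ('l::finite ^ 'k::finite)"
  assumes "\<phi> \<in> wreath_sym"
  shows "J_characteristic (act_vector \<phi> x) u $ act_tuple \<phi> t
       = J_characteristic x (inv (snd \<phi>) ` u) $ t"
proof -
  obtain h g where \<phi>: "\<phi> = (h, g)" and h: "\<And>j. bij (h j)" and g: "bij g"
    using assms by (auto simp: wreath_sym_def)
  have bij: "bij (act_tuple \<phi>)"
    using inj_act_tuple[OF assms] by (simp add: finite_UNIV_inj_surj bij_def)
  have "inj (inv g)" using g by (simp add: bij_imp_bij_inv bij_is_inj)
  then have "inj_on (inv g) u" by (rule inj_on_subset) simp
  then have "J_kernel u (act_tuple \<phi> t) (act_tuple \<phi> r) = J_kernel (inv g ` u) t r" for r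
    using h by (simp add: J_kernel_def prod.reindex \<phi> act_tuple_def bij_is_inj inj_eq)
  moreover have "J_characteristic (act_vector \<phi> x) u $ act_tuple \<phi> t
      = (\<Sum>r\<in>UNIV. J_kernel u (act_tuple \<phi> t) (act_tuple \<phi> r) * act_vector \<phi> x $ act_tuple \<phi> r)"
    unfolding J_characteristic_eq_kernel_sum by (rule sum.reindex_bij_betw[OF bij, symmetric])
  ultimately show ?thesis
    by (simp add: J_characteristic_eq_kernel_sum act_vector_act_tuple[OF assms[unfolded \<phi>]] \<phi>)
qed

lemma finite_wreath_orbit: "finite (wreath_orbit x)"
  by (simp add: wreath_orbit_def)

text \<open>
  Applying \<open>f\<close> to a linear combination that equals \<open>z\<close> shows that its coefficients add up
  to \<open>1\<close>.
\<close>

lemma span_hyperplane_subset_affine_hull: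
  fixes f :: "'v::real_vector \<Rightarrow> real"
  assumes "finite S" "linear f" "\<And>y. y \<in> S \<Longrightarrow> f y = c" "c \<noteq> 0" "z \<in> span S" "f z = c"
  shows "z \<in> affine hull S"
proof -
  obtain q where q: "z = (\<Sum>y\<in>S. q y *\<^sub>R y)"
    using assms(1,5) by (auto simp: span_finite)
  have "c = (\<Sum>y\<in>S. q y * f y)"
    using assms(2,6) by (simp add: q linear_sum linear_cmul)
  also have "\<dots> = sum q S * c"
    using assms(3) by (simp add: sum_distrib_right)
  finally have "sum q S = 1" using assms(4) by simp
  then show ?thesis
    using assms(1) q by (auto simp: affine_hull_finite)
qed

section \<open>J-characteristics of orthogonal arrays\<close>

lemma sum_frequency_vector:
  fixes A :: "('l::finite ^ 'k::finite) list"
  shows "(\<Sum>i\<in>UNIV. f i * frequency_vector A $ i) = (\<Sum>r\<leftarrow>A. f r)"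
proof (induction A)
  case (Cons r A)
  have "(\<Sum>i\<in>UNIV. f i * frequency_vector (r # A) $ i)
      = (\<Sum>i\<in>UNIV. (if i = r then f i else 0) + f i * frequency_vector A $ i)"
    by (intro sum.cong) (auto simp: frequency_vector_def algebra_simps)
  then show ?case by (simp add: sum.distrib Cons)
qed (simp add: frequency_vector_def)

lemma sum_length_filter_fibres:
  fixes f :: "'a \<Rightarrow> 'b::finite"
  shows "(\<Sum>c\<in>UNIV. length (filter (\<lambda>r. f r = c \<and> P r) A)) = length (filter P A)"
proof (induction A)
  case (Cons r A)
  have "(\<Sum>c\<in>UNIV. length (filter (\<lambda>r. f r = c \<and> P r) (r # A)))
      = (\<Sum>c\<in>UNIV. (if c = f r then of_bool (P r) else 0) + length (filter (\<lambda>r. f r = c \<and> P r) A))"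
    by (intro sum.cong) auto
  then show ?case by (simp add: sum.distrib Cons)
qed simp

text \<open>
  An array of strength \<open>s\<close> has every smaller strength too: a set \<open>v\<close> of fewer than
  \<open>s\<close> columns is enlarged one column at a time, and the rows are sorted by the symbol in the
  new column.
\<close>

lemma orthogonal_array_lower_strength:
  fixes A :: "('l::finite ^ 'k::finite) list"
  assumes OA: "orthogonal_array lam s A" and s: "s \<le> CARD('k)"
  shows "card v \<le> s \<Longrightarrow>
    length (filter (\<lambda>r. \<forall>j\<in>v. r $ j = t $ j) A) = lam * CARD('l) ^ (s - card v)"
proof (induction "s - card v" arbitrary: v t)
  case 0
  then show ?case using OA by (simp add: orthogonal_array_def)
next
  case (Suc m)
  have "card v < CARD('k)" using Suc(2) s by linarith
  then obtain j where j: "j \<notin> v"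
    by (metis card_mono finite not_le subsetI UNIV_I)
  have card: "card (insert j v) = Suc (card v)" using j by simp
  have "length (filter (\<lambda>r. \<forall>j\<in>v. r $ j = t $ j) A)
      = (\<Sum>c\<in>UNIV. length (filter (\<lambda>r. r $ j = c \<and> (\<forall>j\<in>v. r $ j = t $ j)) A))"
    by (rule sum_length_filter_fibres[symmetric])
  also have "\<dots> = (\<Sum>c\<in>(UNIV :: 'l set). lam * CARD('l) ^ (s - card (insert j v)))"
  proof (rule sum.cong[OF refl])
    fix c :: 'l
    let ?t = "(\<chi> j'. if j' = j then c else t $ j') :: 'l ^ 'k"
    have "(r $ j = c \<and> (\<forall>j\<in>v. r $ j = t $ j)) \<longleftrightarrow> (\<forall>j\<in>insert j v. r $ j = ?t $ j)" for r
      using j by auto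
    then show "length (filter (\<lambda>r. r $ j = c \<and> (\<forall>j\<in>v. r $ j = t $ j)) A)
        = lam * CARD('l) ^ (s - card (insert j v))"
      using Suc(1)[of "insert j v" ?t] Suc(2) card by simp
  qed
  also have "\<dots> = lam * CARD('l) ^ (s - card v)"
  proof -
    have "s - card v = Suc (s - card (insert j v))" using Suc(2) card by linarith
    then show ?thesis by simp
  qed
  finally show ?case .
qed

text \<open>
  With the sign, the factors of \<open>J_kernel\<close> become \<open>1 - n [r\<^sub>j = t\<^sub>j]\<close>. Expanding
  their product over the subsets \<open>v\<close> of \<open>u\<close> counts the rows that agree with \<open>t\<close> on
  \<open>v\<close>, and it exposes the power of \<open>n\<close> in each term.
\<close>

lemma J_characteristic_frequency_vector:
  fixes A :: "('l::finite ^ 'k::finite) list"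
  shows "(- 1) ^ card u * J_characteristic (frequency_vector A) u $ t
       = (\<Sum>v\<in>Pow u. (- real CARD('l)) ^ card v * real (length (filter (\<lambda>r. \<forall>j\<in>v. r $ j = t $ j) A)))"
proof -
  have kernel: "(- 1) ^ card u * J_kernel u t r
      = (\<Sum>v\<in>Pow u. (- real CARD('l)) ^ card v * of_bool (\<forall>j\<in>v. r $ j = t $ j))" for r
  proof -
    have "(- 1) ^ card u * J_kernel u t r = (\<Prod>j\<in>u. (- real CARD('l)) * of_bool (r $ j = t $ j) + 1)"
      by (simp add: J_kernel_def flip: prod_uminus)
    also have "\<dots> = (\<Sum>v\<in>Pow u. \<Prod>j\<in>v. (- real CARD('l)) * of_bool (r $ j = t $ j))"
      by (subst prod_add) simp_all
    finally show ?thesis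
      by (simp only: prod.distrib prod_constant prod_of_bool[OF finite])
  qed
  have swap: "(\<Sum>r\<leftarrow>A. \<Sum>v\<in>Pow u. a v * of_bool (P v r)) = (\<Sum>v\<in>Pow u. a v * real (length (filter (P v) A)))"
    for a :: "'k set \<Rightarrow> real" and P
  proof (induction A)
    case (Cons r A)
    have "(\<Sum>v\<in>Pow u. a v * real (length (filter (P v) (r # A))))
        = (\<Sum>v\<in>Pow u. a v * of_bool (P v r) + a v * real (length (filter (P v) A)))"
      by (intro sum.cong) (auto simp: algebra_simps)
    then show ?case by (simp only: list.map sum_list.Cons sum.distrib Cons)
  qed simp
  have "(- 1) ^ card u * J_characteristic (frequency_vector A) u $ t
      = (\<Sum>r\<leftarrow>A. (- 1) ^ card u * J_kernel u t r)"
    by (simp add: J_characteristic_eq_kernel_sum sum_frequency_vector sum_list_const_mult)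
  then show ?thesis
    by (simp only: kernel swap)
qed

lemma alternating_sum_small_subsets:
  assumes "finite u" "u \<noteq> {}"
  shows "(\<Sum>v | v \<subseteq> u \<and> card v \<le> s. (- 1) ^ card v) = ((- 1) ^ s * real ((card u - 1) choose s))"
proof -
  have pos: "card u \<ge> 1" using assms by (simp add: Suc_le_eq card_gt_0_iff)
  have "(\<Sum>v | v \<subseteq> u \<and> card v \<le> s. (- 1) ^ card v)
      = (\<Sum>d\<in>{..s} \<inter> {0..card u}. real (card u choose d) * (- 1) ^ d)"
    using sum_card_subsets[OF assms(1), of "\<lambda>d. (- 1) ^ d :: real" "{..s}"] by simp
  also have "\<dots> = (\<Sum>d\<le>s. real (card u choose d) * (- 1) ^ d)"
    by (rule sum.mono_neutral_left) (auto simp: binomial_eq_0)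
  also have "\<dots> = (- 1) ^ s * (real (card u) - 1 gchoose s)"
    using gbinomial_sum_lower_neg[of "real (card u)" s] by (simp add: binomial_gbinomial)
  finally show ?thesis
    using pos by (simp add: binomial_gbinomial of_nat_diff)
qed

text \<open>
  The integer \<open>q\<close> collects the subsets of \<open>u\<close> with more than \<open>s\<close> elements, about
  which the array property says nothing beyond the divisibility of their terms by
  \<open>n ^ (s + 1)\<close>. For \<open>card u \<le> s\<close> there are none of them, and the binomial
  coefficient is \<open>0\<close>, so the whole expression vanishes.
\<close>

lemma J_characteristic_orthogonal_array:
  fixes A :: "('l::finite ^ 'k::finite) list"
  assumes OA: "orthogonal_array lam s A" and s: "s \<le> CARD('k)" and u: "u \<noteq> {}"
  obtains q :: int where
    "(- 1) ^ card u * J_characteristic (frequency_vector A) u $ t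
      = real CARD('l) ^ s * ((- 1) ^ s * real (lam * ((card u - 1) choose s)) + real CARD('l) * of_int q)"
    "card u \<le> s \<Longrightarrow> q = 0"
proof -
  let ?n = "real CARD('l)"
  define c where "c v = length (filter (\<lambda>r. \<forall>j\<in>v. r $ j = t $ j) A)" for v
  define q where "q = (\<Sum>v | v \<subseteq> u \<and> \<not> card v \<le> s.
      (- 1) ^ card v * int CARD('l) ^ (card v - Suc s) * int (c v))"
  have small: "(- ?n) ^ card v * real (c v) = ?n ^ s * real lam * (- 1) ^ card v" if "card v \<le> s" for v
  proof -
    have "(- ?n) ^ card v * real (c v) = real lam * (- 1) ^ card v * (?n ^ card v * ?n ^ (s - card v))"
      using orthogonal_array_lower_strength[OF OA s that, of t]
      by (simp add: c_def power_minus[of ?n])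
    then show ?thesis using that by (simp flip: power_add)
  qed
  have large: "(- ?n) ^ card v * real (c v)
      = ?n ^ Suc s * of_int ((- 1) ^ card v * int CARD('l) ^ (card v - Suc s) * int (c v))"
    if "\<not> card v \<le> s" for v
  proof -
    have "?n ^ card v = ?n ^ Suc s * ?n ^ (card v - Suc s)"
      using that by (simp only: power_add[symmetric]) simp
    then show ?thesis by (simp add: power_minus[of ?n])
  qed
  have "(- 1) ^ card u * J_characteristic (frequency_vector A) u $ t
      = (\<Sum>v\<in>Pow u. (- ?n) ^ card v * real (c v))"
    by (simp add: J_characteristic_frequency_vector c_def)
  also have "\<dots> = (\<Sum>v | v \<subseteq> u \<and> card v \<le> s. (- ?n) ^ card v * real (c v))
      + (\<Sum>v | v \<subseteq> u \<and> \<not> card v \<le> s. (- ?n) ^ card v * real (c v))"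
    by (subst sum.union_disjoint[symmetric]) (auto intro!: sum.cong)
  also have "(\<Sum>v | v \<subseteq> u \<and> card v \<le> s. (- ?n) ^ card v * real (c v))
      = ?n ^ s * real lam * (\<Sum>v | v \<subseteq> u \<and> card v \<le> s. (- 1) ^ card v)"
    unfolding sum_distrib_left by (intro sum.cong refl) (use small in auto)
  also have "(\<Sum>v | v \<subseteq> u \<and> \<not> card v \<le> s. (- ?n) ^ card v * real (c v)) = ?n ^ Suc s * of_int q"
    unfolding q_def of_int_sum sum_distrib_left by (intro sum.cong refl) (use large in auto)
  finally have "(- 1) ^ card u * J_characteristic (frequency_vector A) u $ t
      = ?n ^ s * ((- 1) ^ s * real (lam * ((card u - 1) choose s)) + ?n * of_int q)"
    unfolding alternating_sum_small_subsets[OF finite u] by (simp add: algebra_simps)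
  moreover have "q = 0" if "card u \<le> s"
  proof -
    have "card v \<le> s" if "v \<subseteq> u" for v
      using card_mono[OF finite that] \<open>card u \<le> s\<close> by linarith
    then show ?thesis unfolding q_def by (intro sum.neutral) auto
  qed
  ultimately show thesis using that by blast
qed

lemma J_characteristic_orthogonal_array_zero:
  assumes "orthogonal_array lam s (A :: ('l::finite ^ 'k::finite) list)" "s \<le> CARD('k)"
    and "1 \<le> card u" "card u \<le> s"
  shows "J_characteristic (frequency_vector A) u = 0"
proof -
  have "J_characteristic (frequency_vector A) u $ t = 0" for t
  proof -
    have "u \<noteq> {}" using assms(3) by auto
    then obtain q :: int where
      "(- 1) ^ card u * J_characteristic (frequency_vector A) u $ t
        = real CARD('l) ^ s * ((- 1) ^ s * real (lam * ((card u - 1) choose s)) + real CARD('l) * of_int q)"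
      "q = 0"
      using J_characteristic_orthogonal_array[OF assms(1,2), of u t] assms(4) by metis
    then show ?thesis using assms(3,4) by (simp add: binomial_eq_0)
  qed
  then show ?thesis by (simp add: vec_eq_iff)
qed

lemma J_characteristic_orthogonal_array_empty:
  assumes "orthogonal_array lam s (A :: ('l::finite ^ 'k::finite) list)"
  shows "J_characteristic (frequency_vector A) {} $ t = real lam * real CARD('l) ^ s"
  using assms sum_frequency_vector[of "\<lambda>_. 1" A]
  by (simp add: J_characteristic_eq_kernel_sum J_kernel_def orthogonal_array_def sum_list_triv)

text \<open>
  When the left-hand side of the formula in \<open>J_characteristic_orthogonal_array\<close> is \<open>0\<close>,
  dividing by \<open>n ^ s\<close> leaves a congruence modulo \<open>n\<close>.
\<close>

lemma orthogonal_array_vanishing_degree: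
  assumes "orthogonal_array lam s (A :: ('l::finite ^ 'k::finite) list)" "s \<le> CARD('k)"
    and "u \<noteq> {}" and "J_characteristic (frequency_vector A) u = 0"
  shows "CARD('l) dvd lam * ((card u - 1) choose s)"
proof -
  let ?b = "lam * ((card u - 1) choose s)"
  obtain q :: int where
    "(- 1) ^ card u * J_characteristic (frequency_vector A) u $ (undefined :: 'l ^ 'k)
      = real CARD('l) ^ s * ((- 1) ^ s * real ?b + real CARD('l) * of_int q)"
    using J_characteristic_orthogonal_array[OF assms(1-3)] by metis
  then have "(- 1) ^ s * real ?b + real CARD('l) * of_int q = 0"
    using assms(4) by simp
  then have "real_of_int ((- 1) ^ s * int ?b + int CARD('l) * q) = real_of_int 0"
    by simp
  then have "(- 1) ^ s * int ?b = int CARD('l) * (- q)"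
    unfolding of_int_eq_iff by simp
  then have "int CARD('l) dvd (- 1) ^ s * int ?b"
    by (metis dvd_triv_left)
  then have "int CARD('l) dvd int ?b"
    by (cases "even s") simp_all
  then show ?thesis by (simp only: int_dvd_int_iff)
qed

section \<open>The affine hull of the orbit\<close>

theorem theorem7:
  fixes lam n k s :: nat
    and A :: "('l::finite ^ 'k::finite) list"
    and x :: "real ^ ('l ^ 'k)"
  assumes "CARD('l) = n" and "CARD('k) = k"
    and "lam \<ge> 1" and "n \<ge> 2" and "k \<ge> 1" and "1 \<le> s" and "s \<le> k"
    and "orthogonal_array lam s A"
    and "x = frequency_vector A"
  shows "\<exists>T \<subseteq> Omega2 lam n k s.
    aff_dim (convex hull (wreath_orbit x)) =
      int n ^ k - (\<Sum>j=0..s. int (k choose j) * (int n - 1) ^ j)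
                - (\<Sum>d\<in>T. int (k choose d) * (int n - 1) ^ d) \<and>
    affine hull (convex hull (wreath_orbit x)) = affine hull (wreath_orbit x) \<and>
    affine hull (wreath_orbit x) =
      {z :: real ^ ('l ^ 'k). \<forall>i :: 'l ^ 'k.
         J_characteristic z {} $ i = real lam * real n ^ s \<and>
         (\<forall>u :: 'k set. 1 \<le> card u \<and> card u \<le> s \<longrightarrow> J_characteristic z u $ i = 0) \<and>
         (\<forall>u :: 'k set. card u \<in> T \<longrightarrow> J_characteristic z u $ i = 0)}"
proof -
  note n = assms(1) and k = assms(2) and OA = assms(8) and x = assms(9)
  have s: "s \<le> CARD('k)" using assms(7) k by simp
  define T where "T = {d \<in> {s + 1..k}. \<forall>u :: 'k set. card u = d \<longrightarrow> J_characteristic x u = 0}"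
  define D where "D = {0..s} \<union> T"
  define M where "M = {z :: real ^ ('l ^ 'k). \<forall>i :: 'l ^ 'k.
         J_characteristic z {} $ i = real lam * real n ^ s \<and>
         (\<forall>u :: 'k set. 1 \<le> card u \<and> card u \<le> s \<longrightarrow> J_characteristic z u $ i = 0) \<and>
         (\<forall>u :: 'k set. card u \<in> T \<longrightarrow> J_characteristic z u $ i = 0)}"
  have x_empty: "J_characteristic x {} $ i = real lam * real n ^ s" for i
    using J_characteristic_orthogonal_array_empty[OF OA] by (simp add: x n)
  have x_zero: "J_characteristic x u = 0" if "card u \<in> D" "u \<noteq> {}" for u
  proof (cases "card u \<in> T")
    case False
    then have "1 \<le> card u" "card u \<le> s"
      using that by (auto simp: D_def Suc_le_eq card_gt_0_iff)
    then show ?thesis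
      using J_characteristic_orthogonal_array_zero[OF OA s] by (simp add: x)
  qed (simp add: T_def)
  have pos: "real lam * real n ^ s \<noteq> 0" using assms(3,4) by simp

  have T_Omega2: "T \<subseteq> Omega2 lam n k s"
  proof
    fix d assume d: "d \<in> T"
    then have range: "s + 1 \<le> d" "d \<le> k" by (auto simp: T_def)
    obtain u :: "'k set" where u: "card u = d"
      using obtain_subset_with_card_n[of d "UNIV :: 'k set"] range(2) k by auto
    have "u \<noteq> {}" using u range(1) by auto
    moreover have "J_characteristic x u = 0" using d u by (auto simp: T_def)
    ultimately have "n dvd lam * ((d - 1) choose s)"
      using orthogonal_array_vanishing_degree[OF OA s, of u] u range n x by auto
    also have "(d - 1) choose s = (d - 1) choose (d - 1 - s)"
      using range by (intro binomial_symmetric) simp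
    finally show "d \<in> Omega2 lam n k s"
      using range by (simp add: Omega2_def cong_0_iff)
  qed

  \<comment> \<open>The right-hand sides in the equations that define \<open>M\<close> are the values for \<open>x\<close>, so
    \<open>M\<close> is a translate of a linear subspace.\<close>
  have M_iff: "z \<in> M \<longleftrightarrow> (\<forall>u. card u \<in> D \<longrightarrow> J_characteristic z u = J_characteristic x u)" for z
  proof
    assume z: "z \<in> M"
    show "\<forall>u. card u \<in> D \<longrightarrow> J_characteristic z u = J_characteristic x u"
    proof (intro allI impI)
      fix u :: "'k set" assume u: "card u \<in> D"
      show "J_characteristic z u = J_characteristic x u"
      proof (cases "u = {}")
        case True
        then show ?thesis using z by (simp add: M_def vec_eq_iff x_empty)
      next
        case False
        then have "1 \<le> card u" by (simp add: Suc_le_eq card_gt_0_iff)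
        then have "J_characteristic z u = 0"
          using z u by (auto simp: M_def D_def vec_eq_iff)
        then show ?thesis using x_zero[OF u False] by simp
      qed
    qed
  next
    assume z: "\<forall>u. card u \<in> D \<longrightarrow> J_characteristic z u = J_characteristic x u"
    have "J_characteristic z {} = J_characteristic x {}"
      using z by (simp add: D_def)
    moreover have "J_characteristic z u = 0" if "1 \<le> card u \<and> card u \<le> s \<or> card u \<in> T" for u
    proof -
      have "card u \<in> D" "u \<noteq> {}" using that by (auto simp: D_def T_def)
      then show ?thesis using z x_zero by simp
    qed
    ultimately show "z \<in> M" by (auto simp: M_def x_empty)
  qed
  have M_translate: "M = (+) x ` J_vanishing D"
  proof -
    have "z \<in> M \<longleftrightarrow> z - x \<in> J_vanishing D" for z
      by (simp add: M_iff J_vanishing_def linear_diff[OF linear_J_characteristic])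
    moreover have "z - x \<in> J_vanishing D \<longleftrightarrow> z \<in> (+) x ` J_vanishing D" for z
      by (auto intro: image_eqI[where x = "z - x"])
    ultimately show ?thesis by blast
  qed

  have orbit_M: "wreath_orbit x \<subseteq> M"
  proof
    fix y assume "y \<in> wreath_orbit x"
    then obtain \<phi> where \<phi>: "\<phi> \<in> wreath_sym" and y: "y = act_vector \<phi> x"
      by (auto simp: wreath_orbit_def)
    have "inj (inv (snd \<phi>))"
      using \<phi> by (auto simp: wreath_sym_def bij_imp_bij_inv bij_is_inj)
    then have card: "card (inv (snd \<phi>) ` u) = card u" for u
      by (rule card_image[OF inj_on_subset[OF _ subset_UNIV]])
    have "J_characteristic y u $ i = J_characteristic x u $ i" if u: "card u \<in> D" for u i
    proof -
      have "act_tuple \<phi> (inv (act_tuple \<phi>) i) = i"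
        using inv_act_tuple_eq_iff[OF \<phi>] by blast
      then have "J_characteristic y u $ i
          = J_characteristic x (inv (snd \<phi>) ` u) $ inv (act_tuple \<phi>) i"
        using J_characteristic_act_vector[OF \<phi>, of x u "inv (act_tuple \<phi>) i"] by (simp add: y)
      then show ?thesis
        using u x_zero[of u] x_zero[of "inv (snd \<phi>) ` u"] card[of u]
        by (cases "u = {}") (simp_all add: x_empty)
    qed
    then show "y \<in> M" by (simp add: M_iff vec_eq_iff)
  qed

  have M_hull: "M \<subseteq> affine hull (wreath_orbit x)"
  proof
    fix z assume z: "z \<in> M"
    have "z \<in> span (wreath_orbit x)"
    proof (rule in_span_wreath_orbitI)
      fix u assume nz: "J_characteristic z u \<noteq> 0"
      show "\<exists>w. card w = card u \<and> J_characteristic x w \<noteq> 0"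
      proof (cases "card u \<in> D")
        case True
        then show ?thesis using z nz by (auto simp: M_iff)
      next
        case False
        moreover have "card u \<le> k" using card_mono[of UNIV u] k by simp
        ultimately show ?thesis by (auto simp: D_def T_def)
      qed
    qed
    moreover have "linear (\<lambda>z :: real ^ ('l ^ 'k). J_characteristic z {} $ undefined)"
      using linear_compose[OF linear_J_characteristic bounded_linear.linear[OF bounded_linear_vec_nth]]
      by (simp add: o_def)
    ultimately show "z \<in> affine hull (wreath_orbit x)"
      using z orbit_M pos finite_wreath_orbit
      by (intro span_hyperplane_subset_affine_hull[where c = "real lam * real n ^ s"
            and f = "\<lambda>z. J_characteristic z {} $ undefined"])
        (auto simp only: M_def)
  qed

  have "affine M"
    using affine_translation subspace_imp_affine[OF subspace_J_vanishing] by (metis M_translate)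
  then have hull: "affine hull (wreath_orbit x) = M"
    using M_hull orbit_M by (intro subset_antisym hull_minimal)

  have "aff_dim (convex hull (wreath_orbit x)) = aff_dim M"
    by (simp add: aff_dim_convex_hull flip: hull)
  also have "\<dots> = int (dim (J_vanishing D :: (real ^ ('l ^ 'k)) set))"
    by (simp add: M_translate aff_dim_translation_eq aff_dim_subspace subspace_J_vanishing)
  also have "\<dots> = int n ^ k - (\<Sum>d\<in>D. int (k choose d) * (int n - 1) ^ d)"
  proof -
    have "D \<subseteq> {0..CARD('k)}" using s k by (auto simp: D_def T_def)
    from dim_J_vanishing[where 'l = 'l, OF this] show ?thesis by (simp add: n k)
  qed
  also have "(\<Sum>d\<in>D. int (k choose d) * (int n - 1) ^ d)
      = (\<Sum>j=0..s. int (k choose j) * (int n - 1) ^ j) + (\<Sum>d\<in>T. int (k choose d) * (int n - 1) ^ d)"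
    unfolding D_def by (rule sum.union_disjoint) (auto simp: T_def)
  finally have dim: "aff_dim (convex hull (wreath_orbit x)) =
      int n ^ k - (\<Sum>j=0..s. int (k choose j) * (int n - 1) ^ j)
                - (\<Sum>d\<in>T. int (k choose d) * (int n - 1) ^ d)"
    by simp
  show ?thesis
    using T_Omega2 dim hull unfolding M_def by (intro exI[of _ T]) simp
qed

end
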